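(* Let $m$ be a positive integer. In each of the following cases the displayed identity holds, and the triple consisting of $n_1=6m+3$ and the denominators $n_2,n_3$ of the second and third unit fractions on the right-hand side is a wild solution of the Erdős–Straus equation for $24m+1$. (1) If $m=11r+3+c(22r+7)$ with $r,c\in\mathbb N$, then $$\frac{4}{24m+1}=\frac{1}{6m+3}+\frac{1}{2(3r+1)(2c+1)(24m+1)}+\frac{1}{6(3r+1)(2c+1)(22r+7)(24m+1)}.$$ (2) If $m=33r-1+c(66r-1)$ with $r\in\mathbb N$, $r>0$, $c\in\mathbb N$, then $$\frac{4}{24m+1}=\frac{1}{6m+3}+\frac{1}{18r(2c+1)(24m+1)}+\frac{1}{18r(2c+1)(66r-1)(24m+1)}.$$ (3) If $m=33r+21+c(66r+43)$ with $r,c\in\mathbb N$, then $$\frac{4}{24m+1}=\frac{1}{6m+3}+\frac{1}{6(3r+2)(2c+1)(24m+1)}+\frac{1}{6(3r+2)(2c+1)(66r+43)(24m+1)}.$$ (4) If $m=33r+9+c(66r+19)$ with $r\in\mathbb N$, $r>0$, $c\in\mathbb N$, then $$\frac{4}{24m+1}=\frac{1}{6m+3}+\frac{1}{6(3r+1)(2c+1)(24m+1)}+\frac{1}{2(3r+1)(2c+1)(66r+19)(24m+1)}.$$ (5) If $m=33r+20+c(66r+41)$ with $r\in\mathbb N$, $r>0$, $c\in\mathbb N$, then $$\frac{4}{24m+1}=\frac{1}{6m+3}+\frac{1}{6(3r+2)(2c+1)(24m+1)}+\frac{1}{2(3r+2)(2c+1)(66r+41)(24m+1)}.$$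
   Context: $\mathbb N$ denotes the set of nonnegative integers. For a positive integer $m$, the Erdős–Straus equation for $n=24m+1$ is $\frac{4}{n}=\frac1{n_1}+\frac1{n_2}+\frac1{n_3}$ in positive integers $n_1,n_2,n_3$. For $n_1=6m+k$ with $1\le k\le 12m$ one has $\frac{4}{24m+1}=\frac{1}{6m+k}+\frac{4k-1}{(6m+k)(24m+1)}$. A solution $(n_1,n_2,n_3)$ is called a wild solution if $n_1=6m+k$ for some integer $1\le k\le 12m$ and there exist an integer $L\ge 2$ (called a multiplier) and positive integers $J_1,J_2$ (called the numerator summands) such that $J_1+J_2=L(4k-1)$, $\gcd(L,J_1,J_2)=1$, $\frac1{n_2}=\frac{J_1}{L(6m+k)(24m+1)}$ and $\frac1{n_3}=\frac{J_2}{L(6m+k)(24m+1)}$. *)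

theory Defs
  imports Complex_Main
begin

definition erdos_straus_solution :: "nat \<Rightarrow> nat \<Rightarrow> nat \<Rightarrow> nat \<Rightarrow> bool" where
  "erdos_straus_solution n n1 n2 n3 \<longleftrightarrow>
     n1 > 0 \<and> n2 > 0 \<and> n3 > 0 \<and>
     4 / rat_of_nat n = 1 / rat_of_nat n1 + 1 / rat_of_nat n2 + 1 / rat_of_nat n3"

text \<open>
  Wild solutions of the equation for \<open>n = 24 m + 1\<close>.  Here \<open>L\<close> is the multiplier and
  \<open>J1\<close>, \<open>J2\<close> are the numerator summands, which split the numerator of
  \<open>4 / (24 m + 1) - 1 / (6 m + k) = (4 k - 1) / ((6 m + k) (24 m + 1))\<close>
  after expansion by \<open>L\<close>.  The subtraction \<open>4 * k - 1\<close> on natural numbers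
  does not truncate, because \<open>k \<ge> 1\<close>.
\<close>

definition wild_solution :: "nat \<Rightarrow> nat \<Rightarrow> nat \<Rightarrow> nat \<Rightarrow> bool" where
  "wild_solution m n1 n2 n3 \<longleftrightarrow>
     erdos_straus_solution (24 * m + 1) n1 n2 n3 \<and>
     (\<exists>k. 1 \<le> k \<and> k \<le> 12 * m \<and> n1 = 6 * m + k \<and>
        (\<exists>L J1 J2. L \<ge> 2 \<and> J1 > 0 \<and> J2 > 0 \<and>
           J1 + J2 = L * (4 * k - 1) \<and>
           gcd L (gcd J1 J2) = 1 \<and>
           1 / rat_of_nat n2 = rat_of_nat J1 / rat_of_nat (L * (6 * m + k) * (24 * m + 1)) \<and>
           1 / rat_of_nat n3 = rat_of_nat J2 / rat_of_nat (L * (6 * m + k) * (24 * m + 1))))"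

end

theory Submission
  imports Defs
begin

(* With k = 3 the numerator 4 k - 1 is 11.  In each case 2 m + 1 = (2 c + 1) q, where q is the last
   linear form in r, so 6 m + 3 = 3 (2 c + 1) q.  The multiplier L is 2 (3 r + 1), 6 r or 2 (3 r + 2),
   and 11 L splits as 3 q + 1 in case (1), as q + 1 in cases (2) and (3), and as q + 3 in cases (4)
   and (5); in the last two, L is coprime to 3. *)

lemma erdos_straus_identity_if_wild_solution:
  assumes "wild_solution m n1 n2 n3"
  shows "4 / rat_of_nat (24 * m + 1) = 1 / rat_of_nat n1 + 1 / rat_of_nat n2 + 1 / rat_of_nat n3"
  using assms unfolding wild_solution_def erdos_straus_solution_def by blast

text \<open>Both fractions come out as unit fractions because \<open>J1\<close> and
  \<open>J2\<close> each divide \<open>L * (6 * m + k)\<close>; the cofactors \<open>d2\<close> and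
  \<open>d3\<close> then become the denominators, up to the factor \<open>24 * m + 1\<close>. What
  remains for each case is a handful of polynomial identities over the naturals and one gcd.\<close>

lemma wild_solutionI:
  fixes m k L J1 J2 d2 d3 :: nat
  assumes k: "1 \<le> k" "k \<le> 12 * m"
    and L: "2 \<le> L" and J: "0 < J1" "0 < J2"
    and sum: "J1 + J2 = L * (4 * k - 1)"
    and gcd: "gcd L (gcd J1 J2) = 1"
    and d2: "L * (6 * m + k) = J1 * d2" and d3: "L * (6 * m + k) = J2 * d3"
  shows "wild_solution m (6 * m + k) (d2 * (24 * m + 1)) (d3 * (24 * m + 1))"
proof -
  define a where "a = 6 * m + k"
  define n where "n = 24 * m + 1"
  have pos: "0 < a" "0 < n"
    using k by (auto simp: a_def n_def)
  have "0 < L * a"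
    using L pos by simp
  then have d_pos: "0 < d2" "0 < d3"
    using d2 d3 by (auto simp: a_def intro: Nat.gr0I)
  have frac: "1 / rat_of_nat (d * n) = rat_of_nat J / rat_of_nat (L * a * n)"
    if "L * a = J * d" "0 < d" "0 < J" for J d
    using that pos by (simp add: that(1))
  have frac2: "1 / rat_of_nat (d2 * n) = rat_of_nat J1 / rat_of_nat (L * a * n)"
    using frac d2 d_pos J by (simp add: a_def)
  have frac3: "1 / rat_of_nat (d3 * n) = rat_of_nat J2 / rat_of_nat (L * a * n)"
    using frac d3 d_pos J by (simp add: a_def)
  \<comment> \<open>This is the source of \<open>4 / n - 1 / a = (4 * k - 1) / (a * n)\<close>.
    Scaled by \<open>L\<close>, the remainder \<open>4 * k - 1\<close> becomes
    \<open>J1 + J2\<close>, and dividing by \<open>L * a * n\<close> gives the three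
    fractions.\<close>
  have "4 * a = n + (4 * k - 1)"
    using k by (simp add: a_def n_def)
  then have "L * (4 * a) = L * n + (J1 + J2)"
    by (simp add: sum distrib_left)
  then have num: "4 * rat_of_nat L * rat_of_nat a =
      rat_of_nat L * rat_of_nat n + rat_of_nat J1 + rat_of_nat J2"
    by (metis (no_types, lifting) add.assoc mult.assoc mult.left_commute of_nat_add of_nat_mult of_nat_numeral)
  have "4 / rat_of_nat n = 4 * rat_of_nat L * rat_of_nat a / rat_of_nat (L * a * n)"
    using pos L by simp
  also have "\<dots> = rat_of_nat L * rat_of_nat n / rat_of_nat (L * a * n)
      + rat_of_nat J1 / rat_of_nat (L * a * n) + rat_of_nat J2 / rat_of_nat (L * a * n)"
    unfolding num by (simp only: add_divide_distrib)
  also have "rat_of_nat L * rat_of_nat n / rat_of_nat (L * a * n) = 1 / rat_of_nat a"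
    using pos L by simp
  finally have "4 / rat_of_nat n = 1 / rat_of_nat a
      + 1 / rat_of_nat (d2 * n) + 1 / rat_of_nat (d3 * n)"
    by (simp only: frac2 frac3)
  then have "erdos_straus_solution n a (d2 * n) (d3 * n)"
    using pos d_pos by (simp only: erdos_straus_solution_def) simp
  then show ?thesis
    unfolding wild_solution_def a_def n_def
    by (intro conjI exI[of _ k] exI[of _ L] exI[of _ J1] exI[of _ J2])
      (use k L J sum gcd frac2 frac3 in \<open>simp_all only: a_def n_def\<close>)
qed

text \<open>Coprimality to 3 depends only on the residue modulo 3, here 1 or 2. This serves the gcd
  condition when a numerator summand is 3.\<close>

lemma coprime_3I:
  fixes a :: nat
  assumes "\<not> 3 dvd a"
  shows "coprime a 3"
proof -
  have "a mod 3 = 1 \<or> a mod 3 = 2"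
    using assms by presburger
  moreover have "coprime (2::nat) 3"
    by (simp add: coprime_iff_gcd_eq_1 gcd_non_0_nat)
  ultimately have "coprime (a mod 3) 3"
    \<comment> \<open>The deleted simp rule would erase the \<open>mod\<close> before the two
      residues can be substituted.\<close>
    by (auto simp del: coprime_mod_left_iff)
  then show ?thesis
    by simp
qed

theorem theorem3p3:
  fixes m :: nat
  assumes "m > 0"
  shows
    "(\<forall>r c :: nat. m = 11 * r + 3 + c * (22 * r + 7) \<longrightarrow>
        4 / rat_of_nat (24 * m + 1) =
          1 / rat_of_nat (6 * m + 3)
          + 1 / rat_of_nat (2 * (3 * r + 1) * (2 * c + 1) * (24 * m + 1))
          + 1 / rat_of_nat (6 * (3 * r + 1) * (2 * c + 1) * (22 * r + 7) * (24 * m + 1)) \<and>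
        wild_solution m (6 * m + 3)
          (2 * (3 * r + 1) * (2 * c + 1) * (24 * m + 1))
          (6 * (3 * r + 1) * (2 * c + 1) * (22 * r + 7) * (24 * m + 1))) \<and>
     (\<forall>r c :: nat. r > 0 \<and> m = 33 * r - 1 + c * (66 * r - 1) \<longrightarrow>
        4 / rat_of_nat (24 * m + 1) =
          1 / rat_of_nat (6 * m + 3)
          + 1 / rat_of_nat (18 * r * (2 * c + 1) * (24 * m + 1))
          + 1 / rat_of_nat (18 * r * (2 * c + 1) * (66 * r - 1) * (24 * m + 1)) \<and>
        wild_solution m (6 * m + 3)
          (18 * r * (2 * c + 1) * (24 * m + 1))
          (18 * r * (2 * c + 1) * (66 * r - 1) * (24 * m + 1))) \<and>
     (\<forall>r c :: nat. m = 33 * r + 21 + c * (66 * r + 43) \<longrightarrow>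
        4 / rat_of_nat (24 * m + 1) =
          1 / rat_of_nat (6 * m + 3)
          + 1 / rat_of_nat (6 * (3 * r + 2) * (2 * c + 1) * (24 * m + 1))
          + 1 / rat_of_nat (6 * (3 * r + 2) * (2 * c + 1) * (66 * r + 43) * (24 * m + 1)) \<and>
        wild_solution m (6 * m + 3)
          (6 * (3 * r + 2) * (2 * c + 1) * (24 * m + 1))
          (6 * (3 * r + 2) * (2 * c + 1) * (66 * r + 43) * (24 * m + 1))) \<and>
     (\<forall>r c :: nat. r > 0 \<and> m = 33 * r + 9 + c * (66 * r + 19) \<longrightarrow>
        4 / rat_of_nat (24 * m + 1) =
          1 / rat_of_nat (6 * m + 3)
          + 1 / rat_of_nat (6 * (3 * r + 1) * (2 * c + 1) * (24 * m + 1))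
          + 1 / rat_of_nat (2 * (3 * r + 1) * (2 * c + 1) * (66 * r + 19) * (24 * m + 1)) \<and>
        wild_solution m (6 * m + 3)
          (6 * (3 * r + 1) * (2 * c + 1) * (24 * m + 1))
          (2 * (3 * r + 1) * (2 * c + 1) * (66 * r + 19) * (24 * m + 1))) \<and>
     (\<forall>r c :: nat. r > 0 \<and> m = 33 * r + 20 + c * (66 * r + 41) \<longrightarrow>
        4 / rat_of_nat (24 * m + 1) =
          1 / rat_of_nat (6 * m + 3)
          + 1 / rat_of_nat (6 * (3 * r + 2) * (2 * c + 1) * (24 * m + 1))
          + 1 / rat_of_nat (2 * (3 * r + 2) * (2 * c + 1) * (66 * r + 41) * (24 * m + 1)) \<and>
        wild_solution m (6 * m + 3)
          (6 * (3 * r + 2) * (2 * c + 1) * (24 * m + 1))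
          (2 * (3 * r + 2) * (2 * c + 1) * (66 * r + 41) * (24 * m + 1)))"
proof -
  have k: "1 \<le> (3::nat)" "3 \<le> 12 * m"
    using assms by auto
  have case1: "wild_solution m (6 * m + 3)
      (2 * (3 * r + 1) * (2 * c + 1) * (24 * m + 1))
      (6 * (3 * r + 1) * (2 * c + 1) * (22 * r + 7) * (24 * m + 1))"
    if "m = 11 * r + 3 + c * (22 * r + 7)" for r c
    \<comment> \<open>The summand \<open>3 * (22 * r + 7)\<close> absorbs the factor 3 of
      \<open>6 * m + 3\<close>, so its cofactor is \<open>L * (2 * c + 1)\<close>. The summand 1
      makes the gcd condition trivial and has cofactor \<open>L * (6 * m + 3)\<close>.\<close>
    using that by (intro wild_solutionI[OF k, of "2 * (3 * r + 1)" "3 * (22 * r + 7)" "1"])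
      (simp_all add: algebra_simps)
  have case2: "wild_solution m (6 * m + 3)
      (18 * r * (2 * c + 1) * (24 * m + 1))
      (18 * r * (2 * c + 1) * (66 * r - 1) * (24 * m + 1))"
    if "r > 0 \<and> m = 33 * r - 1 + c * (66 * r - 1)" for r c
  proof -
    \<comment> \<open>Shifting \<open>r\<close> by one removes the truncated subtractions, so that
      the identities become polynomial.\<close>
    from that obtain s where s: "r = Suc s"
      using gr0_implies_Suc by auto
    have q: "66 * r - 1 = 66 * s + 65" and m: "m = 33 * s + 32 + c * (66 * s + 65)"
      using that by (simp_all add: s)
    show ?thesis
      unfolding q by (intro wild_solutionI[OF k, of "6 * r" "66 * s + 65" "1"])
        (simp_all add: s m algebra_simps)
  qed
  have case3: "wild_solution m (6 * m + 3)
      (6 * (3 * r + 2) * (2 * c + 1) * (24 * m + 1))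
      (6 * (3 * r + 2) * (2 * c + 1) * (66 * r + 43) * (24 * m + 1))"
    if "m = 33 * r + 21 + c * (66 * r + 43)" for r c
    \<comment> \<open>Now the factor 3 stays in the first cofactor,
      \<open>3 * L * (2 * c + 1)\<close>.\<close>
    using that by (intro wild_solutionI[OF k, of "2 * (3 * r + 2)" "66 * r + 43" "1"])
      (simp_all add: algebra_simps)
  have case4: "wild_solution m (6 * m + 3)
      (6 * (3 * r + 1) * (2 * c + 1) * (24 * m + 1))
      (2 * (3 * r + 1) * (2 * c + 1) * (66 * r + 19) * (24 * m + 1))"
    if "m = 33 * r + 9 + c * (66 * r + 19)" for r c
  proof -
    have "coprime (2 * (3 * r + 1)) 3"
      by (rule coprime_3I) presburger
    \<comment> \<open>Regrouping pairs the multiplier with 3, and that inner gcd is already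
      1.\<close>
    then have "gcd (2 * (3 * r + 1)) (gcd (66 * r + 19) 3) = 1"
      by (metis coprime_iff_gcd_eq_1 gcd.left_commute gcd_1_nat)
    then show ?thesis
      using that by (intro wild_solutionI[OF k, of "2 * (3 * r + 1)" "66 * r + 19" "3"])
        (simp_all add: algebra_simps)
  qed
  have case5: "wild_solution m (6 * m + 3)
      (6 * (3 * r + 2) * (2 * c + 1) * (24 * m + 1))
      (2 * (3 * r + 2) * (2 * c + 1) * (66 * r + 41) * (24 * m + 1))"
    if "m = 33 * r + 20 + c * (66 * r + 41)" for r c
  proof -
    have "coprime (2 * (3 * r + 2)) 3"
      by (rule coprime_3I) presburger
    then have "gcd (2 * (3 * r + 2)) (gcd (66 * r + 41) 3) = 1"
      by (metis coprime_iff_gcd_eq_1 gcd.left_commute gcd_1_nat)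
    then show ?thesis
      \<comment> \<open>The summand 3 cancels the 3 in \<open>6 * m + 3\<close>, which is why the
        last denominator starts with 2 instead of 6.\<close>
      using that by (intro wild_solutionI[OF k, of "2 * (3 * r + 2)" "66 * r + 41" "3"])
        (simp_all add: algebra_simps)
  qed
  show ?thesis
    using case1 case2 case3 case4 case5 erdos_straus_identity_if_wild_solution by blast
qed

end
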